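(* Let $n\in\mathbb{N}\cup\{\infty\}$, let $(G,+,0)$ be an abelian group, and let $\mathbf{c}=(c_i)_{i\in\mathbb{Z}_n}$ be a sequence of elements of $G$ with $c_0=0$ such that $\{c_i\mid i\in\mathbb{Z}_n\}$ generates $G$. Then the automorphism group of the solution $\mathcal{S}(G\times\mathbb{Z}_n,\mathbf{c})$ is regular, i.e. it acts regularly on the set $G\times\mathbb{Z}_n$.
   Context: $\mathbb{N}$ denotes the positive integers. $\mathbb{Z}_n=\mathbb{Z}/n\mathbb{Z}$ for finite $n$, and $\mathbb{Z}_\infty=\mathbb{Z}$. A solution (set-theoretic, non-degenerate, involutive solution of the Yang-Baxter equation) is a triple $(X,\sigma,\tau)$ with $X$ a non-empty set and $\sigma,\tau\colon X^2\to X$ such that, writing $\sigma_x=\sigma(x,\cdot)$ and $\tau_y=\tau(\cdot,y)$, the map $r(x,y)=(\sigma_x(y),\tau_y(x))$ is a bijection of $X^2$ satisfying $(\mathrm{id}\times r)(r\times \mathrm{id})(\mathrm{id}\times r)=(r\times \mathrm{id})(\mathrm{id}\times r)(r\times \mathrm{id})$, all $\sigma_x,\tau_y$ are bijections, and $r^2=\mathrm{id}$. $\mathcal{S}(G\times\mathbb{Z}_n,\mathbf{c})$ denotes the solution $(G\times\mathbb{Z}_n,\sigma,\tau)$ with $\sigma_{(a,i)}((b,j))=(b+c_{i-j-1}-c_{-j-1},j+1)$ and $\tau_{(a,i)}((b,j))=(b-c_{i-j+1}+c_{-j},j-1)$. A homomorphism from $(X,\sigma,\tau)$ to $(X',\sigma',\tau')$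 is a map $\Phi\colon X\to X'$ with $\Phi\sigma_x=\sigma'_{\Phi(x)}\Phi$ for all $x\in X$; an automorphism is a bijective homomorphism of a solution to itself. *)

theory Defs
  imports "HOL-Algebra.Algebra" "HOL-Library.Extended_Nat"
begin

section \<open>Set-theoretic solutions of the Yang-Baxter equation\<close>

text \<open>Both operations are curried and only meaningful on \<open>pts S\<close>. The paper's permutations are
  \<open>\<sigma>\<^sub>x = lact S x\<close> and \<open>\<tau>\<^sub>y = (\<lambda>x. ract S x y)\<close>.\<close>

record 'a solution_data =
  pts :: "'a set"
  lact :: "'a \<Rightarrow> 'a \<Rightarrow> 'a"
  ract :: "'a \<Rightarrow> 'a \<Rightarrow> 'a"

definition rmap :: "'a solution_data \<Rightarrow> 'a \<times> 'a \<Rightarrow> 'a \<times> 'a" where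
  "rmap S = (\<lambda>(x, y). (lact S x y, ract S x y))"

definition r_id :: "'a solution_data \<Rightarrow> 'a \<times> 'a \<times> 'a \<Rightarrow> 'a \<times> 'a \<times> 'a" where
  "r_id S = (\<lambda>(x, y, z). (fst (rmap S (x, y)), snd (rmap S (x, y)), z))"

definition id_r :: "'a solution_data \<Rightarrow> 'a \<times> 'a \<times> 'a \<Rightarrow> 'a \<times> 'a \<times> 'a" where
  "id_r S = (\<lambda>(x, y, z). (x, rmap S (y, z)))"

definition is_solution :: "'a solution_data \<Rightarrow> bool" where
  "is_solution S \<longleftrightarrow>
     pts S \<noteq> {} \<and>
     bij_betw (rmap S) (pts S \<times> pts S) (pts S \<times> pts S) \<and>
     (\<forall>t \<in> pts S \<times> pts S \<times> pts S.
        id_r S (r_id S (id_r S t)) = r_id S (id_r S (r_id S t))) \<and>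
     (\<forall>x \<in> pts S. bij_betw (lact S x) (pts S) (pts S)) \<and>
     (\<forall>y \<in> pts S. bij_betw (\<lambda>x. ract S x y) (pts S) (pts S)) \<and>
     (\<forall>p \<in> pts S \<times> pts S. rmap S (rmap S p) = p)"

definition solution_hom :: "'a solution_data \<Rightarrow> 'b solution_data \<Rightarrow> ('a \<Rightarrow> 'b) set" where
  "solution_hom S T = {\<Phi> \<in> pts S \<rightarrow> pts T.
     \<forall>x \<in> pts S. \<forall>y \<in> pts S. \<Phi> (lact S x y) = lact T (\<Phi> x) (\<Phi> y)}"

text \<open>As for \<^const>\<open>Bij\<close>, automorphisms are extensional, so that each of them is represented by
  exactly one HOL function.\<close>

definition solution_Aut :: "'a solution_data \<Rightarrow> ('a \<Rightarrow> 'a) monoid" where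
  "solution_Aut S = (BijGroup (pts S)) \<lparr>carrier := Bij (pts S) \<inter> solution_hom S S\<rparr>"

section \<open>Regular actions\<close>

definition regular_action ::
    "('a, 'm) monoid_scheme \<Rightarrow> 'b set \<Rightarrow> ('a \<Rightarrow> 'b \<Rightarrow> 'b) \<Rightarrow> bool" where
  "regular_action A E \<phi> \<longleftrightarrow>
     transitive_action A E \<phi> \<and> (\<forall>x \<in> E. stabilizer A \<phi> x = {\<one>\<^bsub>A\<^esub>})"

section \<open>The groups \<open>\<int>\<^sub>n\<close> and the solutions \<open>\<S>(G \<times> \<int>\<^sub>n, c)\<close>\<close>

definition Zn :: "enat \<Rightarrow> int monoid" where
  "Zn n = (case n of enat k \<Rightarrow> integer_mod_group k | \<infinity> \<Rightarrow> integer_group)"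

text \<open>The canonical projection from the integers to \<^const>\<open>Zn\<close>. Index arithmetic in \<open>\<int>\<^sub>n\<close> is done
  on integer representatives and then projected.\<close>

definition to_Zn :: "enat \<Rightarrow> int \<Rightarrow> int" where
  "to_Zn n z = (case n of enat k \<Rightarrow> z mod int k | \<infinity> \<Rightarrow> z)"

text \<open>The abelian group \<open>G\<close> is written multiplicatively, as is usual for \<^locale>\<open>comm_group\<close>.
  Since \<open>\<tau>\<^sub>y(x)\<close> is \<open>ract x y\<close>, the parameter \<open>(a, i)\<close> of \<open>\<tau>\<close> is the second argument of
  \<^const>\<open>ract\<close>.\<close>

definition S_sol :: "('g, 'm) monoid_scheme \<Rightarrow> enat \<Rightarrow> (int \<Rightarrow> 'g) \<Rightarrow> ('g \<times> int) solution_data" where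
  "S_sol G n c =
     \<lparr>pts = carrier G \<times> carrier (Zn n),
      lact = (\<lambda>(a, i) (b, j).
        (b \<otimes>\<^bsub>G\<^esub> c (to_Zn n (i - j - 1)) \<otimes>\<^bsub>G\<^esub> inv\<^bsub>G\<^esub> c (to_Zn n (- j - 1)), to_Zn n (j + 1))),
      ract = (\<lambda>(b, j) (a, i).
        (b \<otimes>\<^bsub>G\<^esub> inv\<^bsub>G\<^esub> c (to_Zn n (i - j + 1)) \<otimes>\<^bsub>G\<^esub> c (to_Zn n (- j)), to_Zn n (j - 1)))\<rparr>"

text \<open>Sanity check: these data do form solutions.\<close>

lemma to_Zn_reduce:
  "to_Zn n (to_Zn n x + y) = to_Zn n (x + y)"
  "to_Zn n (to_Zn n x - y) = to_Zn n (x - y)"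
  "to_Zn n (x - to_Zn n y) = to_Zn n (x - y)"
  "to_Zn n (- to_Zn n y) = to_Zn n (- y)"
  "to_Zn n (x - to_Zn n y - z) = to_Zn n (x - y - z)"
  "to_Zn n (x - to_Zn n y + z) = to_Zn n (x - y + z)"
  "to_Zn n (to_Zn n x - y - z) = to_Zn n (x - y - z)"
  "to_Zn n (to_Zn n x - y + z) = to_Zn n (x - y + z)"
  "to_Zn n (- to_Zn n y - z) = to_Zn n (- y - z)"
proof -
  obtain m where m: "\<And>z. to_Zn n z = z mod m"
    by (cases n) (auto simp: to_Zn_def intro: that[of 0] that)
  have cong: "to_Zn n a = to_Zn n b" if "\<exists>k. a = b + m * k" for a b
    using that by (auto simp: m)
  have ex: "to_Zn n z = z - m * (z div m)" for z
    by (simp add: m minus_mult_div_eq_mod)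
  have *: "to_Zn n (a + s * to_Zn n z) = to_Zn n (a + s * z)" for a s z
    by (rule cong, rule exI[of _ "- s * (z div m)"]) (simp add: ex[of z] algebra_simps)
  show "to_Zn n (to_Zn n x + y) = to_Zn n (x + y)"
    using *[of y 1 x] by (simp add: algebra_simps)
  show "to_Zn n (to_Zn n x - y) = to_Zn n (x - y)"
    using *[of "- y" 1 x] by (simp add: algebra_simps)
  show "to_Zn n (x - to_Zn n y) = to_Zn n (x - y)"
    using *[of x "-1" y] by (simp add: algebra_simps)
  show "to_Zn n (- to_Zn n y) = to_Zn n (- y)"
    using *[of 0 "-1" y] by (simp add: algebra_simps)
  show "to_Zn n (x - to_Zn n y - z) = to_Zn n (x - y - z)"
    using *[of "x - z" "-1" y] by (simp add: algebra_simps)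
  show "to_Zn n (x - to_Zn n y + z) = to_Zn n (x - y + z)"
    using *[of "x + z" "-1" y] by (simp add: algebra_simps)
  show "to_Zn n (to_Zn n x - y - z) = to_Zn n (x - y - z)"
    using *[of "- y - z" 1 x] by (simp add: algebra_simps)
  show "to_Zn n (to_Zn n x - y + z) = to_Zn n (x - y + z)"
    using *[of "- y + z" 1 x] by (simp add: algebra_simps)
  show "to_Zn n (- to_Zn n y - z) = to_Zn n (- y - z)"
    using *[of "- z" "-1" y] by (simp add: minus_diff_commute[of _ z])
qed

lemma to_Zn_carrier: "n \<noteq> 0 \<Longrightarrow> to_Zn n z \<in> carrier (Zn n)"
  by (cases n) (auto simp: to_Zn_def Zn_def carrier_integer_mod_group zero_enat_def)

lemma to_Zn_id: "z \<in> carrier (Zn n) \<Longrightarrow> to_Zn n z = z"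
  by (cases n) (auto simp: to_Zn_def Zn_def carrier_integer_mod_group split: if_splits)

lemma is_solution_S_sol:
  fixes G (structure)
  assumes n: "n \<noteq> 0" and G: "comm_group G" and c: "c \<in> carrier (Zn n) \<rightarrow> carrier G"
  shows "is_solution (S_sol G n c)"
proof -
  interpret comm_group G by (fact G)
  let ?S = "S_sol G n c" and ?X = "carrier G \<times> carrier (Zn n)"
  have cc [simp]: "c (to_Zn n z) \<in> carrier G" for z
    using c to_Zn_carrier[OF n] by blast
  note [simp] = to_Zn_reduce to_Zn_carrier[OF n] to_Zn_id
  have swap: "k + 1 - l = k - l + 1" "k - 1 - l = k - l - 1"
      "k - (l + 1) = k - l - 1" "k - (l - 1) = k - l + 1" for k l :: int
    by simp_all
  have can: "u \<otimes> v \<otimes> inv w \<otimes> inv v \<otimes> w = u" "u \<otimes> v \<otimes> inv w \<otimes> w \<otimes> inv v = u"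
      "u \<otimes> inv v \<otimes> w \<otimes> v \<otimes> inv w = u" "u \<otimes> inv v \<otimes> w \<otimes> inv w \<otimes> v = u"
    if "u \<in> carrier G" "v \<in> carrier G" "w \<in> carrier G" for u v w
    using that by (metis (no_types, lifting) inv_closed m_assoc m_comm m_closed r_inv r_one)+
  have pts: "pts ?S = ?X" by (simp add: S_sol_def)
  have "\<one> \<in> carrier G" "to_Zn n 0 \<in> carrier (Zn n)" by simp_all
  then have ne: "?X \<noteq> {}" by blast
  have clos: "rmap ?S p \<in> ?X \<times> ?X" if "p \<in> ?X \<times> ?X" for p
    using that by (auto simp: rmap_def S_sol_def)
  have invol: "rmap ?S (rmap ?S p) = p" if "p \<in> ?X \<times> ?X" for p
    using that by (auto simp: rmap_def S_sol_def can swap)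
  have rbij: "bij_betw (rmap ?S) (?X \<times> ?X) (?X \<times> ?X)"
    by (rule bij_betwI[where g = "rmap ?S"]) (use clos invol in auto)
  have lbij: "bij_betw (lact ?S x) ?X ?X" if x: "x \<in> ?X" for x
  proof -
    obtain a i where [simp]: "x = (a, i)" by force
    show ?thesis
      by (rule bij_betwI[where g = "\<lambda>(b, j). (b \<otimes> inv c (to_Zn n (i - j)) \<otimes> c (to_Zn n (- j)),
          to_Zn n (j - 1))"]) (use x in \<open>auto simp: S_sol_def can swap\<close>)
  qed
  have tbij: "bij_betw (\<lambda>x. ract ?S x y) ?X ?X" if y: "y \<in> ?X" for y
  proof -
    obtain a i where [simp]: "y = (a, i)" by force
    show ?thesis
      by (rule bij_betwI[where g = "\<lambda>(b, j). (b \<otimes> c (to_Zn n (i - j)) \<otimes> inv c (to_Zn n (- j - 1)),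
          to_Zn n (j + 1))"]) (use y in \<open>auto simp: S_sol_def can swap\<close>)
  qed
  have braid: "id_r ?S (r_id ?S (id_r ?S t)) = r_id ?S (id_r ?S (r_id ?S t))"
    if "t \<in> ?X \<times> ?X \<times> ?X" for t
  proof -
    have red: "to_Zn n (2 + (to_Zn n k - l)) = to_Zn n (2 + (k - l))" for k l
      using to_Zn_reduce(8)[of n k l 2] by (simp add: add.commute)
    have cancel: "u \<otimes> v \<otimes> w \<otimes> inv v = u \<otimes> w" "u \<otimes> inv v \<otimes> w \<otimes> v = u \<otimes> w"
      if "u \<in> carrier G" "v \<in> carrier G" "w \<in> carrier G" for u v w
    proof -
      have "u \<otimes> v \<otimes> w = u \<otimes> w \<otimes> v" "u \<otimes> inv v \<otimes> w = u \<otimes> w \<otimes> inv v"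
        using that by (simp_all add: m_ac)
      then show "u \<otimes> v \<otimes> w \<otimes> inv v = u \<otimes> w" "u \<otimes> inv v \<otimes> w \<otimes> v = u \<otimes> w"
        using that by (simp_all add: m_assoc)
    qed
    have two: "2 + (k - 1 - l) = k - l + 1" for k l :: int
      by simp
    show ?thesis
      using that by (auto simp: id_r_def r_id_def rmap_def S_sol_def)
        (simp_all add: swap cancel red two, simp_all add: m_ac, simp add: add.commute)
  qed
  show ?thesis
    unfolding is_solution_def pts by (intro conjI ballI ne rbij invol lbij tbij braid)
qed

end

(* All translations (b, j) |-> (b + g, j) are automorphisms, and so is the map
   (b, j) |-> (b - c_{-j-1}, j + 1); together they act transitively.
   Conversely, let an automorphism fix a point x. It then commutes with sigma_x, so it fixes the
   whole sigma_x-orbit of x, which meets every G x {j}. Since sigma_(a,i) depends only on i, the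
   automorphism commutes with every sigma_y, hence its set of fixed points is stable under the group
   generated by all sigma_y. That group is transitive because the c_i generate G. *)

theory Submission
  imports Defs
begin

section \<open>Automorphism groups of solutions\<close>

lemma solution_Aut_iff:
  "\<Phi> \<in> carrier (solution_Aut S) \<longleftrightarrow>
     \<Phi> \<in> Bij (pts S) \<and> (\<forall>x\<in>pts S. \<forall>y\<in>pts S. \<Phi> (lact S x y) = lact S (\<Phi> x) (\<Phi> y))"
  by (auto simp: solution_Aut_def solution_hom_def dest: Bij_imp_funcset)

lemma lact_closed:
  "is_solution S \<Longrightarrow> x \<in> pts S \<Longrightarrow> y \<in> pts S \<Longrightarrow> lact S x y \<in> pts S"
  by (meson is_solution_def bij_betwE)

text \<open>The elements of \<open>BijGroup\<close> are meaningful only on \<open>pts S\<close>.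
  Since \<open>lact S\<close> maps \<open>pts S\<close> into itself, the homomorphism law passes to
  composites and inverses.\<close>

lemma subgroup_solution_Aut:
  assumes S: "is_solution S"
  shows "subgroup (carrier (solution_Aut S)) (BijGroup (pts S))"
proof
  note Pi = Bij_imp_funcset[THEN funcset_mem]
  note lact = lact_closed[OF S]
  show "carrier (solution_Aut S) \<subseteq> carrier (BijGroup (pts S))"
    by (auto simp: solution_Aut_iff BijGroup_def)
  show "\<Phi> \<otimes>\<^bsub>BijGroup (pts S)\<^esub> \<Psi> \<in> carrier (solution_Aut S)"
    if "\<Phi> \<in> carrier (solution_Aut S)" "\<Psi> \<in> carrier (solution_Aut S)" for \<Phi> \<Psi>
    using that by (auto simp: solution_Aut_iff BijGroup_def compose_Bij compose_eq lact Pi)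
  show "\<one>\<^bsub>BijGroup (pts S)\<^esub> \<in> carrier (solution_Aut S)"
    by (auto simp: solution_Aut_iff BijGroup_def id_Bij lact)
  show "inv\<^bsub>BijGroup (pts S)\<^esub> \<Phi> \<in> carrier (solution_Aut S)"
    if "\<Phi> \<in> carrier (solution_Aut S)" for \<Phi>
    using that Bij_inv_into_lemma[of "pts S" \<Phi> "lact S"]
    by (auto simp: solution_Aut_iff inv_BijGroup restrict_inv_into_Bij lact)
qed

lemma group_action_solution_Aut:
  assumes "is_solution S"
  shows "group_action (solution_Aut S) (pts S) (\<lambda>\<Phi>. \<Phi>)"
proof -
  have eq: "solution_Aut S = BijGroup (pts S) \<lparr>carrier := carrier (solution_Aut S)\<rparr>"
    by (simp add: solution_Aut_def)
  have "group_hom (BijGroup (pts S) \<lparr>carrier := carrier (solution_Aut S)\<rparr>) (BijGroup (pts S)) id"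
    by (rule group.canonical_inj_is_hom[OF group_BijGroup subgroup_solution_Aut[OF assms]])
  then show ?thesis
    by (simp add: group_action_def id_def flip: eq)
qed

text \<open>An automorphism fixing \<open>x\<close> commutes with \<open>lact S x\<close>, which is
  injective on \<open>pts S\<close>. The equivalence lets fixed points be followed along an orbit of
  \<open>lact S x\<close> in both directions.\<close>

lemma fixed_point_lact_iff:
  assumes S: "is_solution S" and \<Phi>: "\<Phi> \<in> carrier (solution_Aut S)"
    and x: "x \<in> pts S" "\<Phi> x = x" and y: "y \<in> pts S"
  shows "\<Phi> (lact S x y) = lact S x y \<longleftrightarrow> \<Phi> y = y"
proof -
  have "\<Phi> y \<in> pts S"
    using \<Phi> y by (auto simp: solution_Aut_iff dest: Bij_imp_funcset)
  moreover have "inj_on (lact S x) (pts S)"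
    using S x by (simp add: is_solution_def bij_betw_def)
  ultimately show ?thesis
    using \<Phi> x y by (auto simp: solution_Aut_iff dest: inj_onD)
qed

section \<open>The solutions \<open>\<S>(G \<times> \<int>\<^sub>n, c)\<close>\<close>

lemma pts_S_sol: "pts (S_sol G n c) = carrier G \<times> carrier (Zn n)"
  by (simp add: S_sol_def)

lemma lact_S_sol:
  "lact (S_sol G n c) (a, i) (b, j) =
     (b \<otimes>\<^bsub>G\<^esub> c (to_Zn n (i - j - 1)) \<otimes>\<^bsub>G\<^esub> inv\<^bsub>G\<^esub> c (to_Zn n (- j - 1)), to_Zn n (j + 1))"
  by (simp add: S_sol_def)

lemma to_Zn_0: "to_Zn n 0 = 0"
  by (simp add: to_Zn_def split: enat.split)

lemma zero_in_Zn: "n \<noteq> 0 \<Longrightarrow> 0 \<in> carrier (Zn n)"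
  using to_Zn_carrier[of n 0] by (simp add: to_Zn_0)

text \<open>\<open>lact\<close> multiplies the first coordinate by a factor depending only on the
  two indices, and a translation leaves the indices alone; commutativity of \<open>G\<close> does
  the rest.\<close>

lemma translation_in_Aut:
  fixes G (structure)
  assumes n: "n \<noteq> 0" and G: "comm_group G" and c: "c \<in> carrier (Zn n) \<rightarrow> carrier G"
    and g: "g \<in> carrier G"
  shows "(\<lambda>(b, j) \<in> carrier G \<times> carrier (Zn n). (b \<otimes> g, j)) \<in> carrier (solution_Aut (S_sol G n c))"
    (is "?T \<in> _")
proof -
  interpret comm_group G by (fact G)
  have [simp]: "c (to_Zn n z) \<in> carrier G" for z
    using c to_Zn_carrier[OF n] by blast
  note [simp] = to_Zn_carrier[OF n]
  have "bij_betw ?T (carrier G \<times> carrier (Zn n)) (carrier G \<times> carrier (Zn n))"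
    by (rule bij_betwI[where g = "\<lambda>(b, j). (b \<otimes> inv g, j)"]) (use g in \<open>auto simp: m_assoc\<close>)
  moreover have "?T (lact (S_sol G n c) (a, i) (b, j)) = lact (S_sol G n c) (?T (a, i)) (?T (b, j))"
    if "a \<in> carrier G" "b \<in> carrier G" "i \<in> carrier (Zn n)" "j \<in> carrier (Zn n)" for a b i j
    using that g by (simp add: lact_S_sol m_ac)
  ultimately show ?thesis
    by (simp add: solution_Aut_iff Bij_def pts_S_sol)
qed

text \<open>Shifting both arguments preserves \<open>i - j\<close>, and on both sides of the
  homomorphism law the inverse factors are the values of \<open>c\<close> at \<open>- j - 1\<close>
  and \<open>- j - 2\<close>. For the plain index shift these two values would stand on opposite
  sides.\<close>

lemma shift_in_Aut:
  fixes G (structure)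
  assumes n: "n \<noteq> 0" and G: "comm_group G" and c: "c \<in> carrier (Zn n) \<rightarrow> carrier G"
  shows "(\<lambda>(b, j) \<in> carrier G \<times> carrier (Zn n). (b \<otimes> inv c (to_Zn n (- j - 1)), to_Zn n (j + 1)))
    \<in> carrier (solution_Aut (S_sol G n c))" (is "?T \<in> _")
proof -
  interpret comm_group G by (fact G)
  have [simp]: "c (to_Zn n z) \<in> carrier G" for z
    using c to_Zn_carrier[OF n] by blast
  note [simp] = to_Zn_carrier[OF n] to_Zn_reduce to_Zn_id
  have "bij_betw ?T (carrier G \<times> carrier (Zn n)) (carrier G \<times> carrier (Zn n))"
    by (rule bij_betwI[where g = "\<lambda>(b, j). (b \<otimes> c (to_Zn n (- j)), to_Zn n (j - 1))"])
      (auto simp: m_assoc)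
  moreover have "?T (lact (S_sol G n c) (a, i) (b, j)) = lact (S_sol G n c) (?T (a, i)) (?T (b, j))"
    if "a \<in> carrier G" "b \<in> carrier G" "i \<in> carrier (Zn n)" "j \<in> carrier (Zn n)" for a b i j
    using that by (simp add: lact_S_sol m_ac)
  ultimately show ?thesis
    by (simp add: solution_Aut_iff Bij_def pts_S_sol)
qed

lemma transitive_action_S_sol:
  fixes G (structure)
  assumes n: "n \<noteq> 0" and G: "comm_group G" and c: "c \<in> carrier (Zn n) \<rightarrow> carrier G"
  shows "transitive_action (solution_Aut (S_sol G n c)) (carrier G \<times> carrier (Zn n)) (\<lambda>\<Phi>. \<Phi>)"
proof -
  interpret comm_group G by (fact G)
  let ?A = "solution_Aut (S_sol G n c)" and ?X = "carrier G \<times> carrier (Zn n)"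
  have [simp]: "c (to_Zn n z) \<in> carrier G" for z
    using c to_Zn_carrier[OF n] by blast
  note [simp] = to_Zn_carrier[OF n] to_Zn_reduce zero_in_Zn[OF n]
  interpret act: group_action ?A ?X "\<lambda>\<Phi>. \<Phi>"
    using group_action_solution_Aut[OF is_solution_S_sol[OF n G c]] by (simp add: pts_S_sol)
  let ?R = "\<lambda>x y. y \<in> orbit ?A (\<lambda>\<Phi>. \<Phi>) x"
  have R: "?R x y" if "\<Phi> \<in> carrier ?A" "\<Phi> x = y" for \<Phi> x y
    using that by (auto simp: orbit_def)
  have trans: "?R x z" if "?R x y" "?R y z" "x \<in> ?X" "y \<in> ?X" "z \<in> ?X" for x y z
    using act.orbit_trans that by blast
  have sym: "?R y x" if "?R x y" "x \<in> ?X" "y \<in> ?X" for x y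
    using act.orbit_sym that by blast
  have fibre: "?R (b, j) (b', j)" if "b \<in> carrier G" "b' \<in> carrier G" "j \<in> carrier (Zn n)" for b b' j
  proof -
    have "b \<otimes> (inv b \<otimes> b') = b'"
      using that by (simp flip: m_assoc)
    then show ?thesis
      using that by (intro R[OF translation_in_Aut[OF n G c, of "inv b \<otimes> b'"]]) auto
  qed
  have step: "?R (b, to_Zn n z) (b', to_Zn n (z + 1))"
    if "b \<in> carrier G" "b' \<in> carrier G" for b b' z
  proof (rule trans)
    show "?R (b, to_Zn n z) (b \<otimes> inv c (to_Zn n (- z - 1)), to_Zn n (z + 1))"
      using that by (intro R[OF shift_in_Aut[OF n G c]]) simp
    show "?R (b \<otimes> inv c (to_Zn n (- z - 1)), to_Zn n (z + 1)) (b', to_Zn n (z + 1))"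
      using that by (intro fibre) auto
  qed (use that in auto)
  \<comment> \<open>The induction runs over integer representatives, upwards and downwards from 0,
    which treats finite and infinite \<open>n\<close> alike.\<close>
  have from_one: "\<forall>b\<in>carrier G. ?R (\<one>, 0) (b, to_Zn n z)" for z
  proof (induction z rule: int_induct[where k = 0])
    case base
    then show ?case by (simp add: fibre to_Zn_0)
  next
    case (step1 i)
    show ?case
    proof (rule ballI, rule trans)
      show "?R (\<one>, 0) (\<one>, to_Zn n i)" using step1 by simp
      show "?R (\<one>, to_Zn n i) (b, to_Zn n (i + 1))" if "b \<in> carrier G" for b
        using that by (simp add: step)
    qed simp_all
  next
    case (step2 i)
    show ?case
    proof (rule ballI, rule trans)
      show "?R (\<one>, 0) (\<one>, to_Zn n i)" using step2 by simp
      \<comment> \<open>Downwards, \<open>step\<close> is applied at \<open>i - 1\<close> and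
        reversed by symmetry of the orbit relation.\<close>
      show "?R (\<one>, to_Zn n i) (b, to_Zn n (i - 1))" if "b \<in> carrier G" for b
        by (rule sym) (use that step[of b \<one> "i - 1"] in simp_all)
    qed simp_all
  qed
  have base: "?R (\<one>, 0) x" if "x \<in> ?X" for x
    using that from_one[of "snd x"] by (cases x) (simp add: to_Zn_id)
  have "?R x y" if "x \<in> ?X" "y \<in> ?X" for x y
    by (rule trans[OF sym[OF base] base]) (use that in simp_all)
  then show ?thesis
    by unfold_locales (simp add: orbit_def, metis)
qed

lemma Aut_S_sol_fixed_point:
  fixes G (structure)
  assumes n: "n \<noteq> 0" and G: "comm_group G" and c: "c \<in> carrier (Zn n) \<rightarrow> carrier G"
    and c0: "c 0 = \<one>" and gen: "generate G (c ` carrier (Zn n)) = carrier G"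
    and \<Phi>: "\<Phi> \<in> carrier (solution_Aut (S_sol G n c))"
    and x: "x \<in> carrier G \<times> carrier (Zn n)" "\<Phi> x = x"
    and y: "y \<in> carrier G \<times> carrier (Zn n)"
  shows "\<Phi> y = y"
proof -
  interpret comm_group G by (fact G)
  let ?S = "S_sol G n c" and ?X = "carrier G \<times> carrier (Zn n)"
  have cc [simp]: "c (to_Zn n z) \<in> carrier G" for z
    using c to_Zn_carrier[OF n] by blast
  note [simp] = to_Zn_carrier[OF n] to_Zn_reduce to_Zn_0 zero_in_Zn[OF n]
  note fix_iff = fixed_point_lact_iff[OF is_solution_S_sol[OF n G c] \<Phi>, unfolded pts_S_sol]
  obtain a i where ai: "x = (a, i)" "a \<in> carrier G" "i \<in> carrier (Zn n)"
    using x by auto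
  \<comment> \<open>This follows the orbit of \<open>x\<close> under \<open>lact ?S x\<close> both
    ways from index \<open>i\<close>. The first coordinate may stay unspecified, because
    \<open>lact\<close> ignores that of its left argument.\<close>
  have in_fibre: "\<exists>b\<in>carrier G. \<Phi> (b, to_Zn n k) = (b, to_Zn n k)" for k
  proof (induction k rule: int_induct[where k = i])
    case base
    then show ?case using ai x by (auto simp: to_Zn_id)
  next
    case (step1 k)
    then obtain b where "b \<in> carrier G" "\<Phi> (b, to_Zn n k) = (b, to_Zn n k)" by blast
    then show ?case
      using fix_iff[OF x, of "(b, to_Zn n k)"] by (auto simp: ai lact_S_sol)
  next
    case (step2 k)
    then obtain b where b: "b \<in> carrier G" "\<Phi> (b, to_Zn n k) = (b, to_Zn n k)" by blast
    \<comment> \<open>Obtained by solving \<open>lact ?S x (b', k - 1) = (b, k)\<close> for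
      \<open>b'\<close>.\<close>
    define b' where "b' = b \<otimes> inv c (to_Zn n (i - k)) \<otimes> c (to_Zn n (- k))"
    have b': "b' \<in> carrier G" using b by (simp add: b'_def)
    have "u \<otimes> inv v \<otimes> w \<otimes> v \<otimes> inv w = u"
      if "u \<in> carrier G" "v \<in> carrier G" "w \<in> carrier G" for u v w
      using that by (metis (no_types, lifting) inv_closed m_assoc m_comm m_closed r_inv r_one)
    then have "b' \<otimes> c (to_Zn n (i - k)) \<otimes> inv c (to_Zn n (- k)) = b"
      using b by (simp add: b'_def)
    then have "lact ?S x (b', to_Zn n (k - 1)) = (b, to_Zn n k)"
      by (simp add: ai lact_S_sol)
    then show ?case
      using fix_iff[OF x, of "(b', to_Zn n (k - 1))"] b b' by auto
  qed
  \<comment> \<open>As \<open>d\<close> has no influence on \<open>lact ?S (d, k)\<close>, it can be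
    replaced by the first coordinate of a fixed point with index \<open>k\<close>.\<close>
  have lact_iff: "\<Phi> (lact ?S (d, k) u) = lact ?S (d, k) u \<longleftrightarrow> \<Phi> u = u"
    if k: "k \<in> carrier (Zn n)" and u: "u \<in> ?X" for d k u
  proof -
    obtain b where b: "b \<in> carrier G" "\<Phi> (b, k) = (b, k)"
      using in_fibre[of k] k by (auto simp: to_Zn_id)
    have "lact ?S (d, k) u = lact ?S (b, k) u"
      by (cases u) (simp add: lact_S_sol)
    then show ?thesis
      using fix_iff[of "(b, k)" u] b k u by simp
  qed
  \<comment> \<open>For left index 0 the two values of \<open>c\<close> in \<open>lact\<close>
    coincide and cancel, so only the index moves.\<close>
  have shift: "\<Phi> (b, to_Zn n (k + 1)) = (b, to_Zn n (k + 1)) \<longleftrightarrow> \<Phi> (b, to_Zn n k) = (b, to_Zn n k)"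
    if "b \<in> carrier G" for b k
    using lact_iff[of 0 "(b, to_Zn n k)" \<one>] that by (simp add: lact_S_sol m_assoc)
  have level: "\<Phi> (b, to_Zn n k) = (b, to_Zn n k) \<longleftrightarrow> \<Phi> (b, 0) = (b, 0)"
    if "b \<in> carrier G" for b k
  proof (induction k rule: int_induct[where k = 0])
    case (step2 k)
    then show ?case using shift[OF that, of "k - 1"] by simp
  qed (simp_all add: shift that)
  have add_c: "\<Phi> (b \<otimes> c k, 0) = (b \<otimes> c k, 0) \<longleftrightarrow> \<Phi> (b, 0) = (b, 0)"
    if b: "b \<in> carrier G" and k: "k \<in> carrier (Zn n)" for b k
  proof -
    have "c k \<in> carrier G" using c k by blast
    \<comment> \<open>At index -1 the inverse factor is that of \<open>c 0 = \<one>\<close>, so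
      exactly \<open>c k\<close> remains and the index becomes 0.\<close>
    then have "lact ?S (\<one>, k) (b, to_Zn n (- 1)) = (b \<otimes> c k, 0)"
      using to_Zn_reduce(5)[of n k "- 1" 1] to_Zn_reduce(9)[of n "- 1" 1] b k
      by (simp add: lact_S_sol to_Zn_id c0)
    then show ?thesis
      using lact_iff[OF k, of "(b, to_Zn n (- 1))" \<one>] level[OF b] b by simp
  qed
  \<comment> \<open>The quantifier over \<open>b\<close> is inside the induction: a product needs
    the claim for \<open>h2\<close> at \<open>b \<otimes> h1\<close>, and an inverse needs
    \<open>add_c\<close> at \<open>b \<otimes> inv h\<close>.\<close>
  have add_gen: "g \<in> carrier G \<and> (\<forall>b\<in>carrier G. \<Phi> (b \<otimes> g, 0) = (b \<otimes> g, 0) \<longleftrightarrow> \<Phi> (b, 0) = (b, 0))"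
    if "g \<in> generate G (c ` carrier (Zn n))" for g
    using that
  proof induction
    case one
    then show ?case by simp
  next
    case (incl h)
    then show ?case using add_c c by auto
  next
    case (inv h)
    then obtain k where k: "h = c k" "k \<in> carrier (Zn n)" "h \<in> carrier G" using c by auto
    have "b \<otimes> inv h \<otimes> c k = b" if "b \<in> carrier G" for b
      using that k by (simp add: m_assoc)
    then show ?case
      using add_c[of "_ \<otimes> inv h" k] k by (metis inv_closed m_closed)
  next
    case (eng h1 h2)
    then show ?case by (simp flip: m_assoc)
  qed
  \<comment> \<open>The path from \<open>x\<close> to \<open>y\<close>: move to index 0, change
    \<open>a\<close> into \<open>b\<close> there through the generators, then move to index
    \<open>j\<close>.\<close>
  have "\<Phi> (a, 0) = (a, 0)"
    using level[of a i] ai x by (simp add: to_Zn_id)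
  moreover obtain b j where bj: "y = (b, j)" "b \<in> carrier G" "j \<in> carrier (Zn n)"
    using y by auto
  moreover have "a \<otimes> (inv a \<otimes> b) = b"
    using ai bj by (simp flip: m_assoc)
  ultimately have "\<Phi> (b, 0) = (b, 0)"
    using add_gen[of "inv a \<otimes> b"] ai gen by (metis inv_closed m_closed)
  then show ?thesis
    using level[of b j] bj by (simp add: to_Zn_id)
qed

theorem proposition4p6:
  fixes G :: "('g, 'm) monoid_scheme" and n :: enat and c :: "int \<Rightarrow> 'g"
  assumes "n \<noteq> 0"
    and "comm_group G"
    and "c \<in> carrier (Zn n) \<rightarrow> carrier G"
    and "c 0 = \<one>\<^bsub>G\<^esub>"
    and "generate G (c ` carrier (Zn n)) = carrier G"
  shows "regular_action (solution_Aut (S_sol G n c)) (carrier G \<times> carrier (Zn n)) (\<lambda>\<Phi>. \<Phi>)"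
proof -
  let ?A = "solution_Aut (S_sol G n c)" and ?X = "carrier G \<times> carrier (Zn n)"
  interpret transitive_action ?A ?X "\<lambda>\<Phi>. \<Phi>"
    by (rule transitive_action_S_sol[OF assms(1-3)])
  have one: "\<one>\<^bsub>?A\<^esub> = (\<lambda>x\<in>?X. x)" and one_in: "\<one>\<^bsub>?A\<^esub> \<in> carrier ?A"
    using id_eq_one group_hom by (auto simp: group_hom_def group.is_monoid)
  have "\<Phi> = \<one>\<^bsub>?A\<^esub>" if "\<Phi> \<in> carrier ?A" "x \<in> ?X" "\<Phi> x = x" for \<Phi> x
  \<comment> \<open>Fixing every point of \<open>?X\<close> determines the function, since both
    sides are extensional on \<open>?X\<close>.\<close>
  proof (rule extensionalityI[of _ ?X])
    show "\<Phi> \<in> extensional ?X"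
      using bij_prop0 that by (simp add: Bij_def)
    show "\<Phi> y = \<one>\<^bsub>?A\<^esub> y" if "y \<in> ?X" for y
      using Aut_S_sol_fixed_point[OF assms \<open>\<Phi> \<in> carrier ?A\<close> \<open>x \<in> ?X\<close> \<open>\<Phi> x = x\<close> that] that
      by (simp add: one)
  qed (simp add: one)
  moreover have "\<one>\<^bsub>?A\<^esub> x = x" if "x \<in> ?X" for x
    using that by (simp only: one restrict_apply')
  ultimately have "stabilizer ?A (\<lambda>\<Phi>. \<Phi>) x = {\<one>\<^bsub>?A\<^esub>}" if "x \<in> ?X" for x
    unfolding stabilizer_def using that one_in by blast
  then show ?thesis
    by (simp add: regular_action_def transitive_action_S_sol assms)
qed

end
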